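(* Let $\vartheta\in\mathcal{G}(\mathbb{R}^d)$ be a Gaussian distribution with parameters $(\mu,\Sigma)$, where $\mu=(\mu_1,\dots,\mu_d)$ satisfies $\mu_i\neq0$ for all $i=1,\dots,d$. Then the orbit of $\vartheta$ under the action of $D(d)$ is isomorphic to $D(d)$ (as a set with $D(d)$-action, $D(d)$ acting on itself by multiplication), and the stabilizer of $\vartheta$ in $D(d)$ is trivial.
   Context: $\mathcal{G}(\mathbb{R}^d)$ is the set of (possibly degenerate) Gaussian distributions $\mathcal{N}(\mu,\Sigma)$ on $\mathbb{R}^d$, identified with the set of pairs $(\mu,\Sigma)$ where $\mu\in\mathbb{R}^d$ and $\Sigma$ is a symmetric positive semidefinite $d\times d$ real matrix. $D(d)$ is the group of invertible diagonal real $d\times d$ matrices; it acts on $\mathcal{G}(\mathbb{R}^d)$ by pushforward: $A\cdot\mathcal{N}(\mu,\Sigma)=\mathcal{N}(A\mu,A\Sigma A^\top)$. *)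

theory Defs
  imports "HOL-Analysis.Analysis" "HOL-Algebra.Group_Action"
begin

section \<open>Sets with a group action and their isomorphisms\<close>

text \<open>
  Following \<^locale>\<open>group_action\<close>, an action on a carrier set \<open>E\<close> consists of bijections that
  are extensional, i.e. \<open>undefined\<close> outside \<open>E\<close>.  This is why every action below is
  written with a restricted abstraction.
\<close>

definition left_mult :: "('a, 'm) monoid_scheme \<Rightarrow> 'a \<Rightarrow> 'a \<Rightarrow> 'a" where
  "left_mult G g = (\<lambda>h \<in> carrier G. g \<otimes>\<^bsub>G\<^esub> h)"

definition restrict_action :: "('a \<Rightarrow> 'b \<Rightarrow> 'b) \<Rightarrow> 'b set \<Rightarrow> 'a \<Rightarrow> 'b \<Rightarrow> 'b" where
  "restrict_action \<phi> F g = restrict (\<phi> g) F"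

definition gset_isomorphic ::
  "('a, 'm) monoid_scheme \<Rightarrow> 'b set \<Rightarrow> ('a \<Rightarrow> 'b \<Rightarrow> 'b) \<Rightarrow> 'c set \<Rightarrow> ('a \<Rightarrow> 'c \<Rightarrow> 'c) \<Rightarrow> bool" where
  "gset_isomorphic G E \<phi> F \<psi> \<longleftrightarrow>
     group_action G E \<phi> \<and> group_action G F \<psi> \<and>
     (\<exists>f. bij_betw f E F \<and> (\<forall>g \<in> carrier G. \<forall>x \<in> E. f (\<phi> g x) = \<psi> g (f x)))"


section \<open>Gaussian distributions and the diagonal group\<close>

definition pos_semidef :: "real^'d^'d \<Rightarrow> bool" where
  "pos_semidef \<Sigma> \<longleftrightarrow> transpose \<Sigma> = \<Sigma> \<and> (\<forall>x. 0 \<le> x \<bullet> (\<Sigma> *v x))"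

text \<open>
  A possibly degenerate Gaussian distribution is identified with its pair of parameters,
  the mean and the covariance matrix.
\<close>

definition gaussians :: "((real^'d) \<times> (real^'d^'d)) set" where
  "gaussians = {(\<mu>, \<Sigma>). pos_semidef \<Sigma>}"

definition diagonal_matrix :: "real^'d^'d \<Rightarrow> bool" where
  "diagonal_matrix A \<longleftrightarrow> (\<forall>i j. i \<noteq> j \<longrightarrow> A $ i $ j = 0)"

definition diag_group :: "(real^'d^'d) monoid" where
  "diag_group = \<lparr>carrier = {A. diagonal_matrix A \<and> invertible A}, mult = (**), one = mat 1\<rparr>"

text \<open>The pushforward of a Gaussian along \<open>x \<mapsto> A x\<close>, expressed in its parameters.\<close>

definition gaussian_action ::
  "real^'d^'d \<Rightarrow> (real^'d) \<times> (real^'d^'d) \<Rightarrow> (real^'d) \<times> (real^'d^'d)" where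
  "gaussian_action A = (\<lambda>(\<mu>, \<Sigma>) \<in> gaussians. (A *v \<mu>, A ** \<Sigma> ** transpose A))"

lemma diagonal_mult_component:
  assumes "diagonal_matrix A"
  shows "(A ** B) $ i $ j = A $ i $ i * B $ i $ j"
proof -
  have "(A ** B) $ i $ j = (\<Sum>k\<in>UNIV. A $ i $ k * B $ k $ j)"
    by (simp add: matrix_matrix_mult_def)
  also have "\<dots> = (\<Sum>k\<in>{i}. A $ i $ k * B $ k $ j)"
    using assms by (intro sum.mono_neutral_right) (auto simp: diagonal_matrix_def)
  finally show ?thesis by simp
qed

lemma diagonal_matrix_mult:
  "diagonal_matrix A \<Longrightarrow> diagonal_matrix B \<Longrightarrow> diagonal_matrix (A ** B)"
  by (simp add: diagonal_matrix_def[of "A ** B"] diagonal_mult_component)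
     (simp add: diagonal_matrix_def)

lemma group_diag_group: "group (diag_group :: (real^'d^'d) monoid)"
proof (rule groupI)
  fix A :: "real^'d^'d"
  assume "A \<in> carrier diag_group"
  hence dA: "diagonal_matrix A" and iA: "invertible A" by (auto simp: diag_group_def)
  obtain B where B: "A ** B = mat 1" "B ** A = mat 1" using iA by (auto simp: invertible_def)
  have "B $ i $ j = 0" if "i \<noteq> j" for i j
  proof -
    have nz: "A $ i $ i * B $ i $ i = 1"
      using diagonal_mult_component[OF dA, of B i i] B by (simp add: mat_def)
    have "A $ i $ i * B $ i $ j = 0"
      using diagonal_mult_component[OF dA, of B i j] B that by (simp add: mat_def)
    with nz show ?thesis by auto
  qed
  hence "diagonal_matrix B" by (simp add: diagonal_matrix_def)
  moreover have "invertible B" using B by (auto simp: invertible_def)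
  ultimately show "\<exists>B\<in>carrier diag_group. B \<otimes>\<^bsub>diag_group\<^esub> A = \<one>\<^bsub>diag_group\<^esub>"
    using B by (auto simp: diag_group_def)
next
  have "diagonal_matrix (mat 1 :: real^'d^'d)"
    by (simp add: diagonal_matrix_def mat_def)
  moreover have "invertible (mat 1 :: real^'d^'d)"
    unfolding invertible_def by (rule exI[of _ "mat 1"]) simp
  ultimately show "\<one>\<^bsub>diag_group\<^esub> \<in> carrier (diag_group :: (real^'d^'d) monoid)"
    by (simp add: diag_group_def)
qed (auto simp: diag_group_def matrix_mul_assoc diagonal_matrix_mult invertible_mult)

lemma pos_semidef_congruence:
  assumes "pos_semidef S"
  shows "pos_semidef (A ** S ** transpose A)"
proof -
  have "0 \<le> x \<bullet> ((A ** S ** transpose A) *v x)" for x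
  proof -
    have "x \<bullet> ((A ** S ** transpose A) *v x) = (transpose A *v x) \<bullet> (S *v (transpose A *v x))"
      by (simp add: dot_lmul_matrix flip: matrix_vector_mul_assoc)
    thus ?thesis using assms by (simp add: pos_semidef_def)
  qed
  thus ?thesis using assms by (simp add: pos_semidef_def matrix_transpose_mul matrix_mul_assoc)
qed

lemma gaussian_action_closed: "x \<in> gaussians \<Longrightarrow> gaussian_action A x \<in> gaussians"
  by (auto simp: gaussian_action_def gaussians_def pos_semidef_congruence)

lemma gaussian_action_mult:
  "x \<in> gaussians \<Longrightarrow> gaussian_action (A ** B) x = gaussian_action A (gaussian_action B x)"
  using gaussian_action_closed[of x B]
  by (cases x)
     (simp add: gaussian_action_def matrix_vector_mul_assoc matrix_transpose_mul matrix_mul_assoc)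

lemma gaussian_action_one: "x \<in> gaussians \<Longrightarrow> gaussian_action (mat 1) x = x"
  by (cases x) (simp add: gaussian_action_def)

lemma group_action_gaussian:
  "group_action (diag_group :: (real^'d^'d) monoid) gaussians gaussian_action"
proof -
  have bij: "gaussian_action A \<in> Bij gaussians" if A: "A \<in> carrier diag_group" for A :: "real^'d^'d"
  proof -
    from A obtain B where "A ** B = mat 1" "B ** A = mat 1"
      by (auto simp: diag_group_def invertible_def)
    hence "bij_betw (gaussian_action A) gaussians gaussians"
      by (intro bij_betw_byWitness[where f' = "gaussian_action B"])
         (auto simp: gaussian_action_closed gaussian_action_one simp flip: gaussian_action_mult)
    thus ?thesis by (simp add: Bij_def gaussian_action_def)
  qed
  have "gaussian_action \<in> hom (diag_group :: (real^'d^'d) monoid) (BijGroup gaussians)"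
  proof (rule homI)
    fix A B :: "real^'d^'d"
    assume AB: "A \<in> carrier diag_group" "B \<in> carrier diag_group"
    have "gaussian_action (A ** B) = compose gaussians (gaussian_action A) (gaussian_action B)"
      by (rule extensionalityI[of _ gaussians])
         (simp_all add: gaussian_action_mult compose_eq, simp_all add: gaussian_action_def)
    thus "gaussian_action (A \<otimes>\<^bsub>diag_group\<^esub> B)
        = gaussian_action A \<otimes>\<^bsub>BijGroup gaussians\<^esub> gaussian_action B"
      using bij[OF AB(1)] bij[OF AB(2)] by (simp add: BijGroup_def diag_group_def)
  next
    fix A :: "real^'d^'d"
    assume "A \<in> carrier diag_group"
    thus "gaussian_action A \<in> carrier (BijGroup gaussians)"
      using bij by (simp add: BijGroup_def)
  qed
  thus ?thesis
    by (simp add: group_action_def group_hom_def group_hom_axioms_def group_diag_group group_BijGroup)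
qed

end

theory Submission
  imports Defs
begin

text \<open>A diagonal matrix scales each coordinate separately, so one that fixes a vector without
  zero entries has every diagonal entry equal to 1. An element of the stabilizer fixes the mean,
  hence is the identity (\<open>stabilizer_gaussian_trivial\<close>). The rest is orbit-stabilizer
  for an arbitrary group action: when the stabilizer of \<open>x\<close> is trivial,
  \<open>g \<mapsto> \<phi> g x\<close> is an equivariant bijection from the group onto the orbit,
  and its inverse is the required isomorphism (\<open>orbit_isomorphic_regular\<close>). That both
  sides are actions at all is checked through the elementary axioms collected in
  \<open>group_actionI\<close>.\<close>

lemma group_actionI:
  assumes "group G"
    and closed: "\<And>g x. g \<in> carrier G \<Longrightarrow> x \<in> E \<Longrightarrow> \<phi> g x \<in> E"
    and ext: "\<And>g. g \<in> carrier G \<Longrightarrow> \<phi> g \<in> extensional E"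
    and one: "\<And>x. x \<in> E \<Longrightarrow> \<phi> \<one>\<^bsub>G\<^esub> x = x"
    and mult: "\<And>g h x. g \<in> carrier G \<Longrightarrow> h \<in> carrier G \<Longrightarrow> x \<in> E \<Longrightarrow> \<phi> (g \<otimes>\<^bsub>G\<^esub> h) x = \<phi> g (\<phi> h x)"
  shows "group_action G E \<phi>"
proof -
  interpret group G by fact
  have bij: "\<phi> g \<in> Bij E" if g: "g \<in> carrier G" for g
  proof -
    \<comment> \<open>Bijectivity comes for free from the group: the action of the inverse of
      \<open>g\<close> undoes that of \<open>g\<close> on either side.\<close>
    have "bij_betw (\<phi> g) E E"
      by (intro bij_betw_byWitness[where f' = "\<phi> (inv\<^bsub>G\<^esub> g)"])
         (auto simp: g closed one simp flip: mult)
    thus ?thesis using ext[OF g] by (simp add: Bij_def)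
  qed
  have "\<phi> \<in> hom G (BijGroup E)"
  proof (rule homI)
    fix g h assume gh: "g \<in> carrier G" "h \<in> carrier G"
    have "\<phi> (g \<otimes>\<^bsub>G\<^esub> h) = compose E (\<phi> g) (\<phi> h)"
      by (rule extensionalityI[of _ E]) (simp_all add: gh ext mult compose_eq)
    thus "\<phi> (g \<otimes>\<^bsub>G\<^esub> h) = \<phi> g \<otimes>\<^bsub>BijGroup E\<^esub> \<phi> h"
      using bij gh by (simp add: BijGroup_def)
  qed (simp add: bij BijGroup_def)
  thus ?thesis
    by (simp add: group_action_def group_hom_def group_hom_axioms_def group_BijGroup is_group)
qed

lemma group_action_left_mult:
  assumes "group G"
  shows "group_action G (carrier G) (left_mult G)"
proof -
  interpret group G by fact
  show ?thesis
    by (rule group_actionI) (simp_all add: left_mult_def is_group m_assoc)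
qed

context group_action
begin

lemma action_orbit_closed:
  assumes "x \<in> E" "g \<in> carrier G" "y \<in> orbit G \<phi> x"
  shows "\<phi> g y \<in> orbit G \<phi> x"
proof -
  interpret G: group G using group_hom by (rule group_hom.axioms)
  from assms obtain h where h: "h \<in> carrier G" "y = \<phi> h x"
    by (auto simp: orbit_def)
  hence "\<phi> g y = \<phi> (g \<otimes> h) x"
    using assms by (simp add: composition_rule)
  thus ?thesis using assms h by (auto simp: orbit_def)
qed

lemma orbit_subset: "x \<in> E \<Longrightarrow> orbit G \<phi> x \<subseteq> E"
  by (auto simp: orbit_def intro: element_image)

text \<open>Orbits are invariant, so the axioms are inherited from \<open>E\<close>; cutting each
  map down to the orbit makes it extensional there.\<close>

lemma group_action_restrict_orbit:
  assumes x: "x \<in> E"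
  shows "group_action G (orbit G \<phi> x) (restrict_action \<phi> (orbit G \<phi> x))"
proof -
  interpret G: group G using group_hom by (rule group_hom.axioms)
  have one: "\<phi> \<one> y = y" if "y \<in> E" for y
    using that by (metis id_eq_one restrict_apply')
  show ?thesis
    using orbit_subset[OF x]
    by (intro group_actionI)
       (auto simp: restrict_action_def action_orbit_closed[OF x] composition_rule one
          G.is_group subset_iff)
qed

text \<open>Surjectivity is the definition of the orbit. For injectivity, two elements that send
  \<open>x\<close> to the same point differ by an element of the stabilizer.\<close>

lemma bij_betw_orbit_map:
  assumes x: "x \<in> E" and stab: "stabilizer G \<phi> x = {\<one>}"
  shows "bij_betw (\<lambda>g. \<phi> g x) (carrier G) (orbit G \<phi> x)"
proof -
  interpret G: group G using group_hom by (rule group_hom.axioms)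
  have "g = h" if gh: "g \<in> carrier G" "h \<in> carrier G" and eq: "\<phi> g x = \<phi> h x" for g h
  proof -
    have "\<phi> (inv h \<otimes> g) x = x"
      using gh x orbit_sym_aux[OF gh(2) x] by (simp add: composition_rule eq)
    hence "inv h \<otimes> g = \<one>"
      using stab gh by (auto simp: stabilizer_def)
    \<comment> \<open>The product being \<open>\<one>\<close> makes \<open>inv h\<close> the inverse
      of \<open>g\<close>; inverting once more gives \<open>g = h\<close>.\<close>
    thus ?thesis using gh by (metis G.inv_closed G.inv_equality G.inv_inv)
  qed
  thus ?thesis by (auto simp: bij_betw_def inj_on_def orbit_def)
qed

lemma orbit_isomorphic_regular:
  assumes x: "x \<in> E" and stab: "stabilizer G \<phi> x = {\<one>}"
  shows "gset_isomorphic G (orbit G \<phi> x) (restrict_action \<phi> (orbit G \<phi> x)) (carrier G) (left_mult G)"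
proof -
  interpret G: group G using group_hom by (rule group_hom.axioms)
  \<comment> \<open>The isomorphism must go from the orbit to the group, so \<open>f\<close> reads
    off the unique \<open>g\<close> that carries \<open>x\<close> to a given point.\<close>
  define f where "f = inv_into (carrier G) (\<lambda>g. \<phi> g x)"
  note bij = bij_betw_orbit_map[OF assms]
  have f_orbit: "f (\<phi> g x) = g" if "g \<in> carrier G" for g
    using bij_betw_inv_into_left[OF bij that] by (simp add: f_def)
  have "f (restrict_action \<phi> (orbit G \<phi> x) g y) = left_mult G g (f y)"
    if g: "g \<in> carrier G" and y: "y \<in> orbit G \<phi> x" for g y
  proof -
    \<comment> \<open>In the coordinate \<open>h\<close> of \<open>y\<close>, acting by
      \<open>g\<close> is left multiplication: both sides equal
      \<open>g \<otimes> h\<close>.\<close>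
    from y obtain h where h: "h \<in> carrier G" "y = \<phi> h x"
      by (auto simp: orbit_def)
    hence "restrict_action \<phi> (orbit G \<phi> x) g y = \<phi> (g \<otimes> h) x"
      using g x y by (simp add: restrict_action_def composition_rule)
    thus ?thesis using g h by (simp add: f_orbit left_mult_def)
  qed
  moreover have "bij_betw f (orbit G \<phi> x) (carrier G)"
    unfolding f_def by (rule bij_betw_inv_into[OF bij])
  ultimately show ?thesis
    unfolding gset_isomorphic_def
    using group_action_restrict_orbit[OF x] group_action_left_mult[OF G.is_group] by blast
qed

end

lemma diagonal_matrix_vector_component:
  assumes "diagonal_matrix A"
  shows "(A *v x) $ i = A $ i $ i * x $ i"
proof -
  have "(A *v x) $ i = (\<Sum>k\<in>UNIV. A $ i $ k * x $ k)"
    by (simp add: matrix_vector_mult_def)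
  also have "\<dots> = (\<Sum>k\<in>{i}. A $ i $ k * x $ k)"
    using assms by (intro sum.mono_neutral_right) (auto simp: diagonal_matrix_def)
  finally show ?thesis by simp
qed

text \<open>Coordinatewise the fixed-point equation reads \<open>A $ i $ i * x $ i = x $ i\<close>,
  and the nonzero \<open>x $ i\<close> cancels.\<close>

lemma diagonal_fix_nonzero_vector:
  assumes A: "diagonal_matrix A" and nz: "\<forall>i. x $ i \<noteq> 0" and "A *v x = x"
  shows "A = mat 1"
proof -
  have "A $ i $ i = 1" for i
    using diagonal_matrix_vector_component[OF A, of x i] assms by simp
  thus ?thesis
    using A by (simp add: vec_eq_iff mat_def diagonal_matrix_def)
qed

lemma stabilizer_gaussian_trivial:
  fixes \<mu> :: "real^'d" and \<Sigma> :: "real^'d^'d"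
  assumes "(\<mu>, \<Sigma>) \<in> gaussians" and "\<forall>i. \<mu> $ i \<noteq> 0"
  shows "stabilizer diag_group gaussian_action (\<mu>, \<Sigma>) = {\<one>\<^bsub>diag_group\<^esub>}"
proof
  show "stabilizer diag_group gaussian_action (\<mu>, \<Sigma>) \<subseteq> {\<one>\<^bsub>diag_group\<^esub>}"
    \<comment> \<open>The first component of the fixed-pair equation is
      \<open>A *v \<mu> = \<mu>\<close>, to which the preceding lemma applies.\<close>
    using assms by (auto simp: stabilizer_def diag_group_def gaussian_action_def
        intro: diagonal_fix_nonzero_vector)
  show "{\<one>\<^bsub>diag_group\<^esub>} \<subseteq> stabilizer diag_group gaussian_action (\<mu>, \<Sigma>)"
    using group_action.stabilizer_one_closed[OF group_action_gaussian assms(1)] by simp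
qed

theorem proposition4p5:
  fixes \<mu> :: "real^'d" and \<Sigma> :: "real^'d^'d"
  assumes "(\<mu>, \<Sigma>) \<in> gaussians"
    and "\<forall>i. \<mu> $ i \<noteq> 0"
  shows "gset_isomorphic diag_group
           (orbit diag_group gaussian_action (\<mu>, \<Sigma>))
           (restrict_action gaussian_action (orbit diag_group gaussian_action (\<mu>, \<Sigma>)))
           (carrier diag_group)
           (left_mult diag_group)
       \<and> stabilizer diag_group gaussian_action (\<mu>, \<Sigma>) = {\<one>\<^bsub>diag_group\<^esub>}"
  using stabilizer_gaussian_trivial[OF assms]
    group_action.orbit_isomorphic_regular[OF group_action_gaussian assms(1)]
  by blast

end
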